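(* Let $A$ be a locale, let $L$ be an intermediate logic specified by an axiom $\top\vdash_{\vec{x}}\top=\phi_{L}$, where $\phi_{L}$ is a term obtained by applying the operation $\vee$ to terms only involving the connectives $\wedge$, $\Rightarrow$ and $\neg$, and let $A_{L}$ be the $L$-sublocale of $A$. Then: (i) $A_{L}$ is a dense sublocale of $A$; (ii) $A_{L}$ satisfies $L$; (iii) for every implicationally open (resp. weakly open, if the connective $\Rightarrow$ does not appear in the term $\phi_{L}$) sublocale $A'$ of $A$, $A'\subseteq A_{L}$ if and only if $A'$ satisfies $L$.
   Context: An intermediate logic $L$ is a propositional logic between intuitionistic and classical logic; here it is obtained from intuitionistic logic by adding a single axiom scheme, presented by a sequent $\top\vdash_{\vec{x}}\top=\phi_{L}(\vec{x})$, where $\phi_{L}(\vec{x})$ is a term, in $n$ variables $\vec{x}$, in the theory of Heyting algebras (signature: constants $0,1$, unary operation $\neg$, binary operations $\vee,\wedge,\Rightarrow$). A locale satisfies $L$ if, regarded as a Heyting algebra, it satisfies $\phi_{L}(\vec{x})=1$ for all values of the variables. For an elementary topos $\mathcal{E}$ with subobject classifier $\Omega$ (an internal Heyting algebra), let $f_{L}:\Omega^{n}\to\Omega$ be the interpretation of $\phi_{L}$ in $\Omega$ and $g_{L}:\Omega^{n}\to\Omega$ the composite of $\Omega^{n}\to 1$ with the truth value $\top:1\to\Omega$. The $L$-topology $j^{\mathcal{E}}_{L}$ on $\mathcal{E}$ is the smallest local operator $j$ on $\mathcal{E}$ such that the equalizer of $f_{L}$ and $g_{L}$ is $j$-dense.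 The $L$-sublocale $A_{L}$ of $A$ is the sublocale of $A$ corresponding (under the standard correspondence between sublocales of $A$ and subtoposes of $\mathbf{Sh}(A)$) to the subtopos $\mathbf{sh}_{j^{\mathbf{Sh}(A)}_{L}}(\mathbf{Sh}(A))\hookrightarrow\mathbf{Sh}(A)$. Sublocales of $A$ correspond to nuclei $j$ on $A$, with frame $A_{j}$ the set of fixed points of $j$ and quotient map $j:A\to A_{j}$; a sublocale is contained in another if and only if its nucleus is pointwise greater than or equal to that of the other. A sublocale with nucleus $j$ is dense if $j(0)=0$; weakly open if $j:A\to A_{j}$ preserves the pseudocomplementation operation; implicationally open if $j:A\to A_{j}$ preserves the Heyting implication operation. *)

theory Defs
  imports Main "HOL-Library.FuncSet"
begin

section \<open>Frames and the Heyting operations of a poset\<close>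

class frame = complete_lattice +
  assumes inf_Sup_frame: "inf a (Sup B) = Sup (inf a ` B)"

text \<open>
  The Heyting operations are attached to a subset \<open>C\<close> of an ordered type through their
  order-theoretic universal properties inside \<open>C\<close>; they are meaningful only when \<open>C\<close> with the
  induced order is a Heyting algebra. Below, \<open>C\<close> is the frame of opens of a sublocale, a
  principal down-set of a frame, or the two truth values.
\<close>

definition zero_on :: "'a::order set \<Rightarrow> 'a" where
  "zero_on C = (LEAST z. z \<in> C)"

definition one_on :: "'a::order set \<Rightarrow> 'a" where
  "one_on C = (GREATEST z. z \<in> C)"

definition meet_on :: "'a::order set \<Rightarrow> 'a \<Rightarrow> 'a \<Rightarrow> 'a" where
  "meet_on C x y = (GREATEST z. z \<in> C \<and> z \<le> x \<and> z \<le> y)"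

definition join_on :: "'a::order set \<Rightarrow> 'a \<Rightarrow> 'a \<Rightarrow> 'a" where
  "join_on C x y = (LEAST z. z \<in> C \<and> x \<le> z \<and> y \<le> z)"

definition imp_on :: "'a::order set \<Rightarrow> 'a \<Rightarrow> 'a \<Rightarrow> 'a" where
  "imp_on C x y = (GREATEST z. z \<in> C \<and> meet_on C z x \<le> y)"

definition neg_on :: "'a::order set \<Rightarrow> 'a \<Rightarrow> 'a" where
  "neg_on C x = (GREATEST z. z \<in> C \<and> meet_on C z x = zero_on C)"

section \<open>Terms in the signature of Heyting algebras\<close>

datatype hterm =
    Var nat
  | Zero
  | One
  | Neg hterm
  | Or hterm hterm
  | And hterm hterm
  | Imp hterm hterm

fun vars :: "hterm \<Rightarrow> nat set" where
  "vars (Var i) = {i}"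
| "vars Zero = {}"
| "vars One = {}"
| "vars (Neg s) = vars s"
| "vars (Or s t) = vars s \<union> vars t"
| "vars (And s t) = vars s \<union> vars t"
| "vars (Imp s t) = vars s \<union> vars t"

fun hsubst :: "(nat \<Rightarrow> hterm) \<Rightarrow> hterm \<Rightarrow> hterm" where
  "hsubst \<sigma> (Var i) = \<sigma> i"
| "hsubst \<sigma> Zero = Zero"
| "hsubst \<sigma> One = One"
| "hsubst \<sigma> (Neg s) = Neg (hsubst \<sigma> s)"
| "hsubst \<sigma> (Or s t) = Or (hsubst \<sigma> s) (hsubst \<sigma> t)"
| "hsubst \<sigma> (And s t) = And (hsubst \<sigma> s) (hsubst \<sigma> t)"
| "hsubst \<sigma> (Imp s t) = Imp (hsubst \<sigma> s) (hsubst \<sigma> t)"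

fun heval :: "'a::order set \<Rightarrow> (nat \<Rightarrow> 'a) \<Rightarrow> hterm \<Rightarrow> 'a" where
  "heval C x (Var i) = x i"
| "heval C x Zero = zero_on C"
| "heval C x One = one_on C"
| "heval C x (Neg s) = neg_on C (heval C x s)"
| "heval C x (Or s t) = join_on C (heval C x s) (heval C x t)"
| "heval C x (And s t) = meet_on C (heval C x s) (heval C x t)"
| "heval C x (Imp s t) = imp_on C (heval C x s) (heval C x t)"

definition satisfies_identity :: "'a::order set \<Rightarrow> hterm \<Rightarrow> bool" where
  "satisfies_identity C \<phi> \<longleftrightarrow> (\<forall>x. range x \<subseteq> C \<longrightarrow> heval C x \<phi> = one_on C)"

fun Or_free :: "hterm \<Rightarrow> bool" where
  "Or_free (Or s t) = False"
| "Or_free (Neg s) = Or_free s"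
| "Or_free (And s t) = (Or_free s \<and> Or_free t)"
| "Or_free (Imp s t) = (Or_free s \<and> Or_free t)"
| "Or_free _ = True"

fun Imp_free :: "hterm \<Rightarrow> bool" where
  "Imp_free (Imp s t) = False"
| "Imp_free (Neg s) = Imp_free s"
| "Imp_free (And s t) = (Imp_free s \<and> Imp_free t)"
| "Imp_free (Or s t) = (Imp_free s \<and> Imp_free t)"
| "Imp_free _ = True"

inductive Or_of_Or_free :: "hterm \<Rightarrow> bool" where
  "Or_free s \<Longrightarrow> Or_of_Or_free s"
| "Or_of_Or_free s \<Longrightarrow> Or_of_Or_free t \<Longrightarrow> Or_of_Or_free (Or s t)"

section \<open>Intermediate logics\<close>

text \<open>
  The Hilbert calculus of intuitionistic propositional logic, with \<open>\<phi>\<close> added as an axiom scheme.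
\<close>

inductive_set axiomatized_logic :: "hterm \<Rightarrow> hterm set" for \<phi> :: hterm where
  axiom_scheme: "hsubst \<sigma> \<phi> \<in> axiomatized_logic \<phi>"
| modus_ponens: "Imp p q \<in> axiomatized_logic \<phi> \<Longrightarrow> p \<in> axiomatized_logic \<phi> \<Longrightarrow> q \<in> axiomatized_logic \<phi>"
| imp_K: "Imp p (Imp q p) \<in> axiomatized_logic \<phi>"
| imp_S: "Imp (Imp p (Imp q r)) (Imp (Imp p q) (Imp p r)) \<in> axiomatized_logic \<phi>"
| And_left: "Imp (And p q) p \<in> axiomatized_logic \<phi>"
| And_right: "Imp (And p q) q \<in> axiomatized_logic \<phi>"
| And_intro: "Imp p (Imp q (And p q)) \<in> axiomatized_logic \<phi>"
| Or_left: "Imp p (Or p q) \<in> axiomatized_logic \<phi>"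
| Or_right: "Imp q (Or p q) \<in> axiomatized_logic \<phi>"
| Or_elim: "Imp (Imp p r) (Imp (Imp q r) (Imp (Or p q) r)) \<in> axiomatized_logic \<phi>"
| Zero_elim: "Imp Zero p \<in> axiomatized_logic \<phi>"
| One_intro: "One \<in> axiomatized_logic \<phi>"
| Neg_elim: "Imp (Neg p) (Imp p Zero) \<in> axiomatized_logic \<phi>"
| Neg_intro: "Imp (Imp p Zero) (Neg p) \<in> axiomatized_logic \<phi>"

definition intuitionistic_logic :: "hterm set" where
  "intuitionistic_logic = axiomatized_logic One"

definition classical_logic :: "hterm set" where
  "classical_logic = axiomatized_logic (Or (Var 0) (Neg (Var 0)))"

definition intermediate_logic :: "hterm set \<Rightarrow> bool" where
  "intermediate_logic L \<longleftrightarrow> intuitionistic_logic \<subseteq> L \<and> L \<subseteq> classical_logic"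

section \<open>Sublocales\<close>

definition nucleus :: "('a::frame \<Rightarrow> 'a) \<Rightarrow> bool" where
  "nucleus k \<longleftrightarrow>
    (\<forall>x. x \<le> k x) \<and> (\<forall>x. k (k x) = k x) \<and> (\<forall>x y. k (inf x y) = inf (k x) (k y))"

definition opens :: "('a::frame \<Rightarrow> 'a) \<Rightarrow> 'a set" where
  "opens k = {x. k x = x}"

definition dense_nucleus :: "('a::frame \<Rightarrow> 'a) \<Rightarrow> bool" where
  "dense_nucleus k \<longleftrightarrow> nucleus k \<and> k bot = bot"

definition weakly_open :: "('a::frame \<Rightarrow> 'a) \<Rightarrow> bool" where
  "weakly_open k \<longleftrightarrow> nucleus k \<and> (\<forall>x. k (neg_on UNIV x) = neg_on (opens k) (k x))"

definition implicationally_open :: "('a::frame \<Rightarrow> 'a) \<Rightarrow> bool" where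
  "implicationally_open k \<longleftrightarrow>
    nucleus k \<and> (\<forall>x y. k (imp_on UNIV x y) = imp_on (opens k) (k x) (k y))"

text \<open>Inclusion of sublocales reverses the pointwise order of nuclei.\<close>

definition sublocale_le :: "('a::frame \<Rightarrow> 'a) \<Rightarrow> ('a \<Rightarrow> 'a) \<Rightarrow> bool" where
  "sublocale_le k' k \<longleftrightarrow> (\<forall>x. k x \<le> k' x)"

section \<open>The topos of sheaves on a locale\<close>

text \<open>
  For \<open>b \<le> a\<close>, \<open>res F a b\<close> restricts sections over \<open>a\<close> to sections over \<open>b\<close>; its other values
  are irrelevant.
\<close>

record ('a, 'x) presheaf =
  sec :: "'a \<Rightarrow> 'x set"
  res :: "'a \<Rightarrow> 'a \<Rightarrow> 'x \<Rightarrow> 'x"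

definition is_presheaf :: "('a::frame, 'x) presheaf \<Rightarrow> bool" where
  "is_presheaf F \<longleftrightarrow>
    (\<forall>a b. b \<le> a \<longrightarrow> res F a b \<in> sec F a \<rightarrow> sec F b) \<and>
    (\<forall>a. \<forall>x\<in>sec F a. res F a a x = x) \<and>
    (\<forall>a b c. c \<le> b \<longrightarrow> b \<le> a \<longrightarrow> (\<forall>x\<in>sec F a. res F b c (res F a b x) = res F a c x))"

definition is_sheaf :: "('a::frame, 'x) presheaf \<Rightarrow> bool" where
  "is_sheaf F \<longleftrightarrow> is_presheaf F \<and>
    (\<forall>U s. (\<forall>u\<in>U. s u \<in> sec F u) \<longrightarrow>
      (\<forall>u\<in>U. \<forall>v\<in>U. res F u (inf u v) (s u) = res F v (inf u v) (s v)) \<longrightarrow>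
      (\<exists>!x. x \<in> sec F (Sup U) \<and> (\<forall>u\<in>U. res F (Sup U) u x = s u)))"

text \<open>
  The components of a morphism are extensional functions, so that equality of morphisms is
  equality in HOL.
\<close>

definition morphism ::
  "('a::frame, 'x) presheaf \<Rightarrow> ('a, 'y) presheaf \<Rightarrow> ('a \<Rightarrow> 'x \<Rightarrow> 'y) \<Rightarrow> bool" where
  "morphism F G \<eta> \<longleftrightarrow>
    (\<forall>a. \<eta> a \<in> sec F a \<rightarrow>\<^sub>E sec G a) \<and>
    (\<forall>a b. b \<le> a \<longrightarrow> (\<forall>x\<in>sec F a. \<eta> b (res F a b x) = res G a b (\<eta> a x)))"

text \<open>Subobjects of a sheaf are represented by families of sets of sections.\<close>

definition subobject :: "('a::frame, 'x) presheaf \<Rightarrow> ('a \<Rightarrow> 'x set) \<Rightarrow> bool" where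
  "subobject F S \<longleftrightarrow> (\<forall>a. S a \<subseteq> sec F a) \<and> is_sheaf (F\<lparr>sec := S\<rparr>)"

text \<open>
  The object \<open>\<Omega>\<close>: sections over \<open>a\<close> are the subobjects of the representable sheaf of \<open>a\<close>, that
  is, the elements below \<open>a\<close>. Finite powers are computed sectionwise.
\<close>

definition Omega :: "('a::frame, 'a) presheaf" where
  "Omega = \<lparr>sec = (\<lambda>a. {..a}), res = (\<lambda>a b u. inf u b)\<rparr>"

definition Omega_pow :: "nat \<Rightarrow> ('a::frame, nat \<Rightarrow> 'a) presheaf" where
  "Omega_pow n =
    \<lparr>sec = (\<lambda>a. {..<n} \<rightarrow>\<^sub>E sec Omega a),
     res = (\<lambda>a b x. \<lambda>i\<in>{..<n}. res Omega a b (x i))\<rparr>"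

text \<open>
  \<open>One_sheaf\<close> is the terminal object, its unique section over \<open>a\<close> being encoded by \<open>a\<close> itself,
  \<open>truth\<close> is the truth value \<open>1 \<rightarrow> \<Omega>\<close>, and \<open>bang F\<close> is the unique morphism \<open>F \<rightarrow> 1\<close>.
\<close>

definition One_sheaf :: "('a::frame, 'a) presheaf" where
  "One_sheaf = \<lparr>sec = (\<lambda>a. {a}), res = (\<lambda>a b u. b)\<rparr>"

definition truth :: "'a::frame \<Rightarrow> 'a \<Rightarrow> 'a" where
  "truth a = (\<lambda>u\<in>sec One_sheaf a. one_on (sec Omega a))"

definition bang :: "('a::frame, 'x) presheaf \<Rightarrow> 'a \<Rightarrow> 'x \<Rightarrow> 'a" where
  "bang F a = (\<lambda>x\<in>sec F a. a)"

definition mor_comp ::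
  "('a::frame, 'x) presheaf \<Rightarrow> ('a \<Rightarrow> 'y \<Rightarrow> 'z) \<Rightarrow> ('a \<Rightarrow> 'x \<Rightarrow> 'y) \<Rightarrow> 'a \<Rightarrow> 'x \<Rightarrow> 'z" where
  "mor_comp F \<theta> \<eta> a = compose (sec F a) (\<theta> a) (\<eta> a)"

definition equalizer ::
  "('a::frame, 'x) presheaf \<Rightarrow> ('a \<Rightarrow> 'x \<Rightarrow> 'y) \<Rightarrow> ('a \<Rightarrow> 'x \<Rightarrow> 'y) \<Rightarrow> 'a \<Rightarrow> 'x set" where
  "equalizer F \<eta> \<theta> a = {x \<in> sec F a. \<eta> a x = \<theta> a x}"

definition classifying ::
  "('a::frame, 'x) presheaf \<Rightarrow> ('a \<Rightarrow> 'x set) \<Rightarrow> 'a \<Rightarrow> 'x \<Rightarrow> 'a" where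
  "classifying F S a = (\<lambda>x\<in>sec F a. Sup {b. b \<le> a \<and> res F a b x \<in> S b})"

section \<open>Local operators\<close>

definition local_operator :: "('a::frame \<Rightarrow> 'a \<Rightarrow> 'a) \<Rightarrow> bool" where
  "local_operator j \<longleftrightarrow> morphism Omega Omega j \<and>
    mor_comp One_sheaf j truth = truth \<and>
    mor_comp Omega j j = j \<and>
    (\<forall>a. \<forall>u\<in>sec Omega a. \<forall>v\<in>sec Omega a. j a (inf u v) = inf (j a u) (j a v))"

definition local_operator_le :: "('a::frame \<Rightarrow> 'a \<Rightarrow> 'a) \<Rightarrow> ('a \<Rightarrow> 'a \<Rightarrow> 'a) \<Rightarrow> bool" where
  "local_operator_le j j' \<longleftrightarrow> (\<forall>a. \<forall>u\<in>sec Omega a. j a u \<le> j' a u)"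

text \<open>The closure of \<open>S\<close> is the subobject classified by \<open>j\<close> composed with the classifying map of \<open>S\<close>.\<close>

definition closure_of_sub ::
  "('a::frame \<Rightarrow> 'a \<Rightarrow> 'a) \<Rightarrow> ('a, 'x) presheaf \<Rightarrow> ('a \<Rightarrow> 'x set) \<Rightarrow> 'a \<Rightarrow> 'x set" where
  "closure_of_sub j F S =
    equalizer F (mor_comp F j (classifying F S)) (mor_comp F truth (bang F))"

definition dense_sub ::
  "('a::frame \<Rightarrow> 'a \<Rightarrow> 'a) \<Rightarrow> ('a, 'x) presheaf \<Rightarrow> ('a \<Rightarrow> 'x set) \<Rightarrow> bool" where
  "dense_sub j F S \<longleftrightarrow> subobject F S \<and> closure_of_sub j F S = sec F"

text \<open>
  The objects of the subtopos \<open>sh\<^sub>j(Sh(A))\<close>. A quantifier over sheaves needs a fixed type of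
  sections, here that of \<open>F\<close>. Nothing is lost: every type carries copies of the representable
  sheaves and of their subobjects, and testing against dense subobjects of representable sheaves
  already determines the \<open>j\<close>-sheaves.
\<close>

definition j_sheaf :: "('a::frame \<Rightarrow> 'a \<Rightarrow> 'a) \<Rightarrow> ('a, 'x) presheaf \<Rightarrow> bool" where
  "j_sheaf j F \<longleftrightarrow> is_sheaf F \<and>
    (\<forall>(X :: ('a, 'x) presheaf) S \<eta>.
      is_sheaf X \<longrightarrow> dense_sub j X S \<longrightarrow> morphism (X\<lparr>sec := S\<rparr>) F \<eta> \<longrightarrow>
      (\<exists>!\<theta>. morphism X F \<theta> \<and> (\<forall>a. \<forall>x\<in>S a. \<theta> a x = \<eta> a x)))"

text \<open>
  The subterminal sheaf of \<open>c\<close>. The subterminal objects of \<open>Sh(A)\<close> are, up to isomorphism,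
  exactly these, and the sublocale corresponding to a subtopos \<open>sh\<^sub>j(Sh(A))\<close> is the one whose
  opens are the subterminal objects that belong to the subtopos.
\<close>

definition subterminal :: "'a::frame \<Rightarrow> ('a, 'a) presheaf" where
  "subterminal c = One_sheaf\<lparr>sec := (\<lambda>a. {u \<in> sec One_sheaf a. a \<le> c})\<rparr>"

definition sublocale_of_subtopos :: "('a::frame \<Rightarrow> 'a \<Rightarrow> 'a) \<Rightarrow> 'a \<Rightarrow> 'a" where
  "sublocale_of_subtopos j = (THE k. nucleus k \<and> opens k = {c. j_sheaf j (subterminal c)})"

section \<open>The topology and the sublocale of an axiom\<close>

text \<open>
  \<open>\<phi>\<close> is considered in the variables with index below \<open>n\<close>. The internal Heyting operations of
  \<open>\<Omega>\<close> are, over \<open>a\<close>, those of the Heyting algebra of elements below \<open>a\<close>.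
\<close>

definition interp_Omega :: "nat \<Rightarrow> hterm \<Rightarrow> 'a::frame \<Rightarrow> (nat \<Rightarrow> 'a) \<Rightarrow> 'a" where
  "interp_Omega n \<phi> a = (\<lambda>x\<in>sec (Omega_pow n) a. heval (sec Omega a) x \<phi>)"

definition axiom_locus :: "nat \<Rightarrow> hterm \<Rightarrow> 'a::frame \<Rightarrow> (nat \<Rightarrow> 'a) set" where
  "axiom_locus n \<phi> =
    equalizer (Omega_pow n) (interp_Omega n \<phi>) (mor_comp (Omega_pow n) truth (bang (Omega_pow n)))"

definition L_topology :: "nat \<Rightarrow> hterm \<Rightarrow> 'a::frame \<Rightarrow> 'a \<Rightarrow> 'a" where
  "L_topology n \<phi> =
    (THE j. local_operator j \<and> dense_sub j (Omega_pow n) (axiom_locus n \<phi>) \<and>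
      (\<forall>j'. local_operator j' \<and> dense_sub j' (Omega_pow n) (axiom_locus n \<phi>) \<longrightarrow>
        local_operator_le j j'))"

definition L_sublocale :: "nat \<Rightarrow> hterm \<Rightarrow> 'a::frame \<Rightarrow> 'a" where
  "L_sublocale n \<phi> = sublocale_of_subtopos (L_topology n \<phi>)"

end

theory Submission
  imports Defs
begin

text \<open>
  A local operator on \<open>Sh(A)\<close> is determined by its component over the top element: naturality forces
  \<open>j a u = a \<and> k u\<close> for a nucleus \<open>k\<close> on \<open>A\<close>, and every nucleus arises
  (\<open>local_operator_iff_nucleus\<close>). The subobject of \<open>\<Omega>\<^sup>n\<close> on which \<open>\<phi>\<close> holds is classified by the
  value of \<open>\<phi>\<close> itself, so it is dense for \<open>k\<close> exactly when \<open>k\<close> sends every value of \<open>\<phi>\<close> in \<open>A\<close> to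
  the top element (\<open>dense_axiom_locus_iff\<close>). Since the subterminal sheaf of \<open>c\<close> is a sheaf for \<open>k\<close> exactly
  when \<open>k c = c\<close> (\<open>j_sheaf_subterminal_iff\<close>), the sublocale of \<open>\<phi>\<close> is the least nucleus \<open>k\<^sub>L\<close> that
  sends all values of \<open>\<phi>\<close> to the top element (\<open>L_sublocale_eq\<close>). The rest is
  Heyting algebra.

  Density: classical theorems have dense values in every frame (Glivenko's theorem,
  \<open>Glivenko\<close>), so double negation sends all values of \<open>\<phi>\<close> to the top element. Hence \<open>k\<^sub>L\<close> lies below double
  negation, which fixes the bottom element.

  Validity of \<open>\<phi>\<close> in \<open>A\<^sub>L\<close>: a dense nucleus changes neither the bottom element nor meets,
  implications and negations of fixed points; only joins have to be corrected by applying the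
  nucleus. As the joins of \<open>\<phi>\<close> are all outermost, the value of \<open>\<phi>\<close> in \<open>A\<^sub>L\<close> is \<open>k\<^sub>L\<close> of its value in
  \<open>A\<close> (\<open>heval_opens_Or_of_Or_free\<close>), which is the top element by the choice of \<open>k\<^sub>L\<close>.

  Universality: the quotient map of an implicationally open sublocale \<open>k\<close> preserves all Heyting
  operations, so the values of \<open>\<phi>\<close> in the sublocale are the images of its values in \<open>A\<close>. Thus
  \<open>\<phi>\<close> holds in the sublocale if and only if \<open>k\<close> sends all values of \<open>\<phi>\<close> to the top element, that is, if and
  only if \<open>k\<^sub>L \<le> k\<close>. For a term without implications it is enough that negations are preserved.
\<close>

section \<open>Heyting implication in a frame\<close>

definition himp :: "'a::frame \<Rightarrow> 'a \<Rightarrow> 'a" where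
  "himp x y = Sup {z. inf z x \<le> y}"

lemma le_himp_iff: "z \<le> himp x y \<longleftrightarrow> inf z x \<le> (y::'a::frame)"
proof
  assume "z \<le> himp x y"
  then have "inf z x \<le> inf x (himp x y)"
    by (simp add: le_infI1 inf.coboundedI1)
  also have "\<dots> \<le> y"
    unfolding himp_def inf_Sup_frame by (auto intro!: Sup_least simp: inf.commute)
  finally show "inf z x \<le> y" .
next
  assume "inf z x \<le> y"
  then show "z \<le> himp x y"
    unfolding himp_def by (auto intro: Sup_upper)
qed

lemma himp_eq_top_iff: "himp x y = top \<longleftrightarrow> x \<le> (y::'a::frame)"
  using le_himp_iff[of top x y] by (simp add: top_unique)

lemma inf_himp_le: "inf (himp x y) x \<le> (y::'a::frame)"
  using le_himp_iff by blast

lemma inf_sup_frame: "inf a (sup x y) = sup (inf a x) (inf a (y::'a::frame))"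
  using inf_Sup_frame[of a "{x, y}"] by simp

section \<open>Heyting operations of down-sets and of sublocales\<close>

lemma one_on_down: "one_on {..a} = (a::'a::frame)"
  unfolding one_on_def by (rule Greatest_equality) auto

lemma zero_on_down: "zero_on {..a} = (bot::'a::frame)"
  unfolding zero_on_def by (rule Least_equality) auto

lemma meet_on_down: "x \<le> a \<Longrightarrow> meet_on {..a} x y = inf x (y::'a::frame)"
  unfolding meet_on_def by (rule Greatest_equality) (auto intro: le_infI1)

lemma join_on_down: "x \<le> a \<Longrightarrow> y \<le> a \<Longrightarrow> join_on {..a} x y = sup x (y::'a::frame)"
  unfolding join_on_def by (rule Least_equality) auto

lemma imp_on_down: "imp_on {..a} x y = inf a (himp x (y::'a::frame))"
  unfolding imp_on_def
proof (rule Greatest_equality)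
  have "inf (inf a (himp x y)) x \<le> y"
    by (meson inf_himp_le inf.cobounded2 inf_mono order_refl order_trans)
  then show "inf a (himp x y) \<in> {..a} \<and> meet_on {..a} (inf a (himp x y)) x \<le> y"
    by (simp add: meet_on_down)
qed (auto simp: meet_on_down le_himp_iff)

lemma neg_on_down: "neg_on {..a} x = inf a (himp x (bot::'a::frame))"
proof -
  have "neg_on {..a} x = imp_on {..a} x bot"
    unfolding neg_on_def imp_on_def by (simp add: zero_on_down le_bot bot_unique)
  then show ?thesis
    by (simp add: imp_on_down)
qed

lemma nucleus_le: "nucleus k \<Longrightarrow> x \<le> k x"
  by (simp add: nucleus_def)

lemma nucleus_idem: "nucleus k \<Longrightarrow> k (k x) = k x"
  by (simp add: nucleus_def)

lemma nucleus_inf: "nucleus k \<Longrightarrow> k (inf x y) = inf (k x) (k y)"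
  by (simp add: nucleus_def)

lemma nucleus_mono: "nucleus k \<Longrightarrow> x \<le> y \<Longrightarrow> k x \<le> k y"
  by (metis inf.absorb_iff1 nucleus_inf)

lemma nucleus_top: "nucleus k \<Longrightarrow> k top = top"
  by (metis nucleus_le top_unique)

lemma nucleus_least_open: "nucleus k \<Longrightarrow> y \<in> opens k \<Longrightarrow> x \<le> y \<Longrightarrow> k x \<le> y"
  using nucleus_mono[of k x y] by (simp add: opens_def)

lemma nucleus_in_opens: "nucleus k \<Longrightarrow> k x \<in> opens k"
  by (simp add: nucleus_idem opens_def)

lemma nucleus_eqI:
  assumes "nucleus k" "nucleus k'" "opens k = opens k'"
  shows "k = k'"
proof (intro ext order_antisym)
  fix x
  show "k x \<le> k' x"
    using assms nucleus_in_opens[of k' x] by (intro nucleus_least_open[of k _ x]) (auto intro: nucleus_le)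
  show "k' x \<le> k x"
    using assms nucleus_in_opens[of k x] by (intro nucleus_least_open[of k' _ x]) (auto intro: nucleus_le)
qed

lemma one_on_opens: "nucleus k \<Longrightarrow> one_on (opens k) = top"
  unfolding one_on_def by (rule Greatest_equality) (auto simp: opens_def nucleus_top)

lemma zero_on_opens: "nucleus k \<Longrightarrow> zero_on (opens k) = k bot"
  unfolding zero_on_def
  by (rule Least_equality) (simp_all add: nucleus_in_opens nucleus_least_open)

lemma inf_in_opens: "nucleus k \<Longrightarrow> x \<in> opens k \<Longrightarrow> y \<in> opens k \<Longrightarrow> inf x y \<in> opens k"
  by (simp add: opens_def nucleus_inf)

lemma meet_on_opens:
  "nucleus k \<Longrightarrow> x \<in> opens k \<Longrightarrow> y \<in> opens k \<Longrightarrow> meet_on (opens k) x y = inf x y"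
  unfolding meet_on_def by (rule Greatest_equality) (auto simp: inf_in_opens)

lemma join_on_opens: "nucleus k \<Longrightarrow> join_on (opens k) x y = k (sup x y)"
  unfolding join_on_def
proof (rule Least_equality)
  assume k: "nucleus k"
  show "k (sup x y) \<in> opens k \<and> x \<le> k (sup x y) \<and> y \<le> k (sup x y)"
    using nucleus_le[OF k, of "sup x y"] by (auto simp: nucleus_in_opens[OF k])
qed (simp add: nucleus_least_open)

text \<open>The fixed points of a nucleus form an exponential ideal, so implications need no correction.\<close>

lemma himp_in_opens:
  assumes k: "nucleus k" and x: "x \<in> opens k" and y: "y \<in> opens k"
  shows "himp x y \<in> opens k"
proof -
  have "inf (k (himp x y)) x = k (inf (himp x y) x)"
    using x by (simp add: nucleus_inf[OF k] opens_def)
  also have "\<dots> \<le> y"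
    by (rule nucleus_least_open[OF k y inf_himp_le])
  finally have "k (himp x y) \<le> himp x y"
    by (simp add: le_himp_iff)
  then show ?thesis
    using nucleus_le[OF k] by (simp add: opens_def order_antisym)
qed

lemma imp_on_opens:
  assumes k: "nucleus k" and x: "x \<in> opens k" and y: "y \<in> opens k"
  shows "imp_on (opens k) x y = himp x y"
  unfolding imp_on_def
  by (rule Greatest_equality)
    (auto simp: meet_on_opens[OF k _ x] himp_in_opens[OF k x y] inf_himp_le le_himp_iff)

lemma neg_on_opens_imp:
  assumes k: "nucleus k" and x: "x \<in> opens k"
  shows "neg_on (opens k) x = imp_on (opens k) x (k bot)"
proof -
  have "inf z x = k bot \<longleftrightarrow> inf z x \<le> k bot" if "z \<in> opens k" for z
    using nucleus_least_open[OF k inf_in_opens[OF k that x], of bot] by (auto intro: order_antisym)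
  then have "(z \<in> opens k \<and> meet_on (opens k) z x = zero_on (opens k)) \<longleftrightarrow>
      (z \<in> opens k \<and> meet_on (opens k) z x \<le> k bot)" for z
    by (auto simp: meet_on_opens[OF k _ x] zero_on_opens[OF k])
  then show ?thesis
    unfolding neg_on_def imp_on_def by simp
qed

lemma neg_on_opens:
  assumes k: "nucleus k" and x: "x \<in> opens k"
  shows "neg_on (opens k) x = himp x (k bot)"
  using assms by (simp add: neg_on_opens_imp imp_on_opens nucleus_in_opens)

text \<open>The whole frame is the sublocale of the identity nucleus.\<close>

lemma nucleus_id: "nucleus (\<lambda>x. x)"
  by (simp add: nucleus_def)

lemma opens_id: "opens (\<lambda>x. x) = UNIV"
  by (simp add: opens_def)

lemmas ops_UNIV [simp] =
  one_on_opens[OF nucleus_id, unfolded opens_id]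
  zero_on_opens[OF nucleus_id, unfolded opens_id]
  meet_on_opens[OF nucleus_id, unfolded opens_id, OF UNIV_I UNIV_I]
  join_on_opens[OF nucleus_id, unfolded opens_id]
  imp_on_opens[OF nucleus_id, unfolded opens_id, OF UNIV_I UNIV_I]
  neg_on_opens[OF nucleus_id, unfolded opens_id, OF UNIV_I]

section \<open>Values of terms under homomorphisms\<close>

lemma heval_cong: "(\<And>i. i \<in> vars \<phi> \<Longrightarrow> x i = y i) \<Longrightarrow> heval C x \<phi> = heval C y \<phi>"
  by (induction \<phi>) auto

text \<open>
  The implication clause is conditional so that one statement serves both implicationally open and
  weakly open sublocales.
\<close>

lemma heval_hom:
  fixes h :: "'a::frame \<Rightarrow> 'a"
  assumes "h bot = zero_on C" "h top = one_on C"
    and "\<And>x y. h (inf x y) = meet_on C (h x) (h y)"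
    and "\<And>x y. h (sup x y) = join_on C (h x) (h y)"
    and "\<And>x. h (himp x bot) = neg_on C (h x)"
    and "Imp_free \<phi> \<or> (\<forall>x y. h (himp x y) = imp_on C (h x) (h y))"
  shows "heval C (\<lambda>i. h (x i)) \<phi> = h (heval UNIV x \<phi>)"
  using assms(6) by (induction \<phi>) (auto simp: assms(1-5))

text \<open>Restriction to an open is a homomorphism onto the Heyting algebra of its subopens.\<close>

lemma heval_down: "heval {..a} (\<lambda>i. inf a (x i)) \<phi> = inf a (heval UNIV x \<phi>)" for a :: "'a::frame"
proof (rule heval_hom[where h = "inf a"])
  have imp: "inf a (himp x y) = inf a (himp (inf a x) (inf a y))" for x y :: 'a
  proof -
    have "z \<le> inf a (himp x y) \<longleftrightarrow> z \<le> inf a (himp (inf a x) (inf a y))" for z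
    proof (cases "z \<le> a")
      case True
      then have "inf z (inf a x) = inf z x" "inf z x \<le> a"
        by (simp_all add: inf.absorb1 le_infI1 flip: inf.assoc)
      then show ?thesis
        using True by (simp add: le_himp_iff)
    qed simp
    then show ?thesis
      by (meson order_antisym order_refl)
  qed
  show "inf a (himp x bot) = neg_on {..a} (inf a x)" for x
    using imp[of x bot] by (simp add: neg_on_down)
  show "Imp_free \<phi> \<or> (\<forall>x y. inf a (himp x y) = imp_on {..a} (inf a x) (inf a y))"
    using imp by (simp add: imp_on_down)
  show "inf a (inf x y) = meet_on {..a} (inf a x) (inf a y)" for x y
    by (simp add: meet_on_down inf_left_commute inf_commute inf_assoc)
qed (simp_all add: one_on_down zero_on_down join_on_down inf_sup_frame)

lemma nucleus_sup:
  assumes k: "nucleus k"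
  shows "k (sup (k x) (k y)) = k (sup x y)"
proof (rule order_antisym)
  have "sup (k x) (k y) \<le> k (sup x y)"
    by (simp add: nucleus_mono[OF k])
  then show "k (sup (k x) (k y)) \<le> k (sup x y)"
    by (rule nucleus_least_open[OF k nucleus_in_opens[OF k]])
  show "k (sup x y) \<le> k (sup (k x) (k y))"
    by (intro nucleus_mono[OF k] sup_mono nucleus_le[OF k])
qed

text \<open>
  The quotient map onto a sublocale always preserves finite meets and joins, which leaves negation and
  implication to be assumed.
\<close>

lemma heval_nucleus:
  assumes k: "nucleus k"
    and neg: "\<And>x. k (neg_on UNIV x) = neg_on (opens k) (k x)"
    and imp: "Imp_free \<phi> \<or> (\<forall>x y. k (imp_on UNIV x y) = imp_on (opens k) (k x) (k y))"
  shows "heval (opens k) (\<lambda>i. k (x i)) \<phi> = k (heval UNIV x \<phi>)"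
  using neg imp
  by (intro heval_hom[where h = k])
    (simp_all add: zero_on_opens[OF k] one_on_opens[OF k] nucleus_top[OF k] nucleus_inf[OF k]
      meet_on_opens[OF k] nucleus_in_opens[OF k] join_on_opens[OF k] nucleus_sup[OF k])

lemma implicationally_open_imp_weakly_open:
  assumes "implicationally_open k"
  shows "weakly_open k"
  using assms
  by (auto simp: implicationally_open_def weakly_open_def neg_on_opens_imp nucleus_in_opens)

section \<open>Terms whose joins are outermost\<close>

lemma heval_opens_Or_free:
  assumes k: "dense_nucleus k" and x: "range x \<subseteq> opens k" and s: "Or_free s"
  shows "heval (opens k) x s = heval UNIV x s \<and> heval UNIV x s \<in> opens k"
proof -
  have n: "nucleus k" and b: "k bot = bot"
    using k by (simp_all add: dense_nucleus_def)
  then have bot: "bot \<in> opens k" and top: "top \<in> opens k"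
    by (simp_all add: opens_def nucleus_top)
  show ?thesis
    using s x
    by (induction s)
      (auto simp: n b bot top zero_on_opens one_on_opens meet_on_opens imp_on_opens neg_on_opens
        inf_in_opens himp_in_opens)
qed

text \<open>
  Passing to the sublocale changes joins only by an application of the nucleus, and for outermost
  joins all these applications merge into a single one. A join below an implication or a negation
  would break this, since a nucleus need not preserve implications.
\<close>

lemma heval_opens_Or_of_Or_free:
  assumes k: "dense_nucleus k" and x: "range x \<subseteq> opens k" and \<phi>: "Or_of_Or_free \<phi>"
  shows "heval (opens k) x \<phi> = k (heval UNIV x \<phi>)"
  using \<phi>
proof induction
  case (1 s)
  then show ?case
    using heval_opens_Or_free[OF k x] by (simp add: opens_def)
next
  case (2 s t)
  have n: "nucleus k"
    using k by (simp add: dense_nucleus_def)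
  show ?case
    by (simp add: 2 join_on_opens[OF n] nucleus_sup[OF n])
qed

section \<open>Double negation and classical theorems\<close>

text \<open>
  Excluded middle takes dense values, modus ponens preserves density, and the intuitionistic axioms
  take the value \<open>top\<close>.
\<close>

lemma Glivenko:
  fixes x :: "nat \<Rightarrow> 'a::frame"
  assumes "p \<in> classical_logic"
  shows "himp (heval UNIV x p) bot = bot"
proof -
  have neg_top: "himp top bot = (bot::'a)"
    using inf_himp_le[of top "bot::'a"] by (simp add: bot_unique)
  have tautology: "himp (heval UNIV x (Imp p q)) bot = bot"
    if "heval UNIV x p \<le> heval UNIV x q" for p q
    using that by (simp add: himp_eq_top_iff[THEN iffD2] neg_top)
  have no_neg: "himp a bot = bot" if "\<And>z. inf z a \<le> bot \<Longrightarrow> z \<le> bot" for a :: 'a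
    using that inf_himp_le[of a bot] by (meson bot_unique)
  have neg_bot: "z \<le> bot" if "himp a bot = bot" "inf z a \<le> bot" for z a :: 'a
    using that le_himp_iff[of z a bot] by simp
  have mp: "inf (himp a b) a \<le> b" for a b :: 'a
    by (rule inf_himp_le)
  have le_mp: "c \<le> b" if "c \<le> inf (himp a b) a" for a b c :: 'a
    using that mp by (rule order_trans)
  show ?thesis
    using assms unfolding classical_logic_def
  proof induction
    case (axiom_scheme \<sigma>)
    show ?case
    proof (rule no_neg)
      fix z assume z: "inf z (heval UNIV x (hsubst \<sigma> (Or (Var 0) (Neg (Var 0))))) \<le> bot"
      let ?a = "heval UNIV x (\<sigma> 0)"
      have *: "sup (inf z ?a) (inf z (himp ?a bot)) \<le> bot"
        using z by (simp add: inf_sup_frame)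
      then have "z \<le> himp ?a bot"
        by (simp add: le_himp_iff)
      then show "z \<le> bot"
        using * by (simp add: inf.absorb1)
    qed
  next
    case (modus_ponens p q)
    let ?p = "heval UNIV x p" and ?q = "heval UNIV x q"
    show ?case
    proof (rule no_neg)
      fix z assume z: "inf z ?q \<le> bot"
      have "inf (inf z (himp ?p ?q)) ?p \<le> inf z ?q"
        unfolding inf.assoc by (intro inf_mono mp order_refl)
      also note z
      finally have "inf z (himp ?p ?q) \<le> bot"
        by (rule neg_bot[OF modus_ponens.IH(2)])
      moreover have "himp (himp ?p ?q) bot = bot"
        using modus_ponens.IH(1) by simp
      ultimately show "z \<le> bot"
        by (rule neg_bot[rotated])
    qed
  next
    case (imp_S p q r)
    show ?case
    proof (rule tautology)
      let ?p = "heval UNIV x p" and ?q = "heval UNIV x q" and ?r = "heval UNIV x r"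
      let ?m = "inf (inf (himp ?p (himp ?q ?r)) (himp ?p ?q)) ?p"
      have "?m \<le> inf (himp ?p (himp ?q ?r)) ?p" and "?m \<le> inf (himp ?p ?q) ?p"
        by (simp_all add: le_infI1)
      from this[THEN le_mp] have "?m \<le> inf (himp ?q ?r) ?q"
        by (rule le_infI)
      then have "?m \<le> ?r"
        by (rule le_mp)
      then show "heval UNIV x (Imp p (Imp q r)) \<le> heval UNIV x (Imp (Imp p q) (Imp p r))"
        by (simp add: le_himp_iff)
    qed
  next
    case (Or_elim p r q)
    show ?case
    proof (rule tautology)
      let ?p = "heval UNIV x p" and ?q = "heval UNIV x q" and ?r = "heval UNIV x r"
      let ?m = "inf (himp ?p ?r) (himp ?q ?r)"
      have "inf ?m ?p \<le> inf (himp ?p ?r) ?p" and "inf ?m ?q \<le> inf (himp ?q ?r) ?q"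
        by (simp_all add: le_infI1)
      from this[THEN le_mp] have "inf ?m (sup ?p ?q) \<le> ?r"
        by (simp add: inf_sup_frame)
      then show "heval UNIV x (Imp p r) \<le> heval UNIV x (Imp (Imp q r) (Imp (Or p q) r))"
        by (simp add: le_himp_iff)
    qed
  next
    case One_intro
    show ?case
      by (simp add: neg_top)
  qed (rule tautology; simp add: le_himp_iff)+
qed

lemma nucleus_double_negation: "nucleus (\<lambda>x::'a::frame. himp (himp x bot) bot)"
proof -
  let ?n = "\<lambda>x::'a. himp x bot"
  have anti: "?n y \<le> ?n x" if "x \<le> y" for x y
    unfolding le_himp_iff using that by (intro order_trans[OF inf_mono inf_himp_le]) simp_all
  have unit: "x \<le> ?n (?n x)" for x
    using inf_himp_le[of x bot] by (simp add: le_himp_iff inf.commute)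
  have triple: "?n (?n (?n x)) = ?n x" for x
    by (intro order_antisym anti unit)
  have disjoint: "inf a (?n (?n b)) \<le> bot" if "a \<le> ?n b" for a b
    using that le_himp_iff[of a "?n (?n b)" bot] by (simp add: triple)
  have "inf (?n (?n x)) (?n (?n y)) \<le> ?n (?n (inf x y))" for x y
  proof -
    \<comment> \<open>Currying twice: \<open>\<not>(x \<and> y) \<and> x\<close> lies below \<open>\<not>y\<close>, so \<open>\<not>(x \<and> y) \<and> \<not>\<not>y\<close> lies below \<open>\<not>x\<close>.\<close>
    let ?w = "?n (inf x y)"
    have "inf (inf ?w x) y \<le> bot"
      using inf_himp_le[of "inf x y" bot] by (simp add: inf.assoc)
    then have "inf ?w x \<le> ?n y"
      by (simp add: le_himp_iff)
    then have "inf (inf ?w x) (?n (?n y)) \<le> bot"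
      by (rule disjoint)
    then have "inf ?w (?n (?n y)) \<le> ?n x"
      by (simp add: le_himp_iff ac_simps)
    then have "inf (inf ?w (?n (?n y))) (?n (?n x)) \<le> bot"
      by (rule disjoint)
    then show ?thesis
      by (simp add: le_himp_iff ac_simps)
  qed
  then have "?n (?n (inf x y)) = inf (?n (?n x)) (?n (?n y))" for x y
    by (intro order_antisym le_infI anti) simp_all
  then show ?thesis
    by (simp add: nucleus_def unit triple)
qed

section \<open>Local operators on sheaves are nuclei\<close>

definition operator_of_nucleus :: "('a::frame \<Rightarrow> 'a) \<Rightarrow> 'a \<Rightarrow> 'a \<Rightarrow> 'a" where
  "operator_of_nucleus k a = (\<lambda>u\<in>{..a}. inf a (k u))"

lemma truth_bang: "x \<in> sec F a \<Longrightarrow> mor_comp F truth (bang F) a x = a"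
  by (simp add: mor_comp_def compose_def truth_def bang_def One_sheaf_def Omega_def one_on_down)

lemma local_operator_of_nucleus:
  assumes k: "nucleus k"
  shows "local_operator (operator_of_nucleus k)"
proof -
  have "inf b (k (inf u b)) = inf (inf a (k u)) b" if "b \<le> a" "u \<le> a" for a b u
  proof -
    have "inf b (k (inf u b)) = inf (inf b (k b)) (k u)"
      by (simp add: nucleus_inf[OF k] inf_assoc inf_commute inf_left_commute)
    also have "\<dots> = inf (inf a b) (k u)"
      using that(1) nucleus_le[OF k, of b] by (simp add: inf.absorb1 inf.absorb2)
    also have "\<dots> = inf (inf a (k u)) b"
      by (simp add: inf_assoc inf_commute inf_left_commute)
    finally show ?thesis .
  qed
  then have "morphism Omega Omega (operator_of_nucleus k)"
    by (auto simp: morphism_def Omega_def operator_of_nucleus_def le_infI2)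
  moreover have "mor_comp One_sheaf (operator_of_nucleus k) truth = truth"
    using nucleus_le[OF k]
    by (auto simp: fun_eq_iff mor_comp_def compose_def truth_def One_sheaf_def Omega_def
        one_on_down operator_of_nucleus_def inf.absorb1)
  moreover have "inf a (k (inf a (k u))) = inf a (k u)" for a u
    using nucleus_le[OF k, of a]
    by (simp add: nucleus_inf[OF k] nucleus_idem[OF k] inf.absorb1 flip: inf.assoc)
  then have "mor_comp Omega (operator_of_nucleus k) (operator_of_nucleus k) = operator_of_nucleus k"
    by (auto simp: fun_eq_iff mor_comp_def compose_def Omega_def operator_of_nucleus_def)
  moreover have "operator_of_nucleus k a (inf u v) =
      inf (operator_of_nucleus k a u) (operator_of_nucleus k a v)" if "u \<le> a" "v \<le> a" for a u v
    using that
    by (simp add: operator_of_nucleus_def nucleus_inf[OF k] le_infI1 inf_left_commute inf_assoc)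
  ultimately show ?thesis
    by (simp add: local_operator_def Omega_def)
qed

text \<open>Naturality along \<open>a \<le> top\<close> recovers all components of \<open>j\<close> from the one over \<open>top\<close>.\<close>

lemma nucleus_of_local_operator:
  assumes j: "local_operator j"
  shows "nucleus (j top)" and "j = operator_of_nucleus (j top)"
proof -
  have j_fun: "j a \<in> {..a} \<rightarrow>\<^sub>E {..a}" for a
    using j by (simp add: local_operator_def morphism_def Omega_def)
  have nat: "j b (inf u b) = inf (j a u) b" if "b \<le> a" "u \<le> a" for a b u
    using j that by (simp add: local_operator_def morphism_def Omega_def)
  have down: "j a u = inf a (j top u)" if "u \<le> a" for a u
    using nat[of a top u] that by (simp add: inf.absorb2 inf.commute[of _ a])
  have "j u u = u" for u
  proof -
    have "mor_comp One_sheaf j truth u u = truth u u"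
      using j by (simp add: local_operator_def)
    then show ?thesis
      by (simp add: mor_comp_def compose_def truth_def One_sheaf_def Omega_def one_on_down)
  qed
  then have "u \<le> j top u" for u
    using down[of u u] by (metis inf.cobounded2 order_refl)
  moreover have "j top (j top u) = j top u" for u
  proof -
    have "mor_comp Omega j j top u = j top u"
      using j by (simp add: local_operator_def)
    then show ?thesis
      by (simp add: mor_comp_def compose_def Omega_def)
  qed
  moreover have "j top (inf u v) = inf (j top u) (j top v)" for u v
    using j by (simp add: local_operator_def Omega_def)
  ultimately show "nucleus (j top)"
    by (simp add: nucleus_def)
  show "j = operator_of_nucleus (j top)"
  proof (intro ext)
    fix a u
    show "j a u = operator_of_nucleus (j top) a u"
    proof (cases "u \<le> a")
      case True
      then show ?thesis
        unfolding operator_of_nucleus_def by (simp only: restrict_apply atMost_iff if_True down)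
    next
      case False
      then show ?thesis
        using PiE_arb[OF j_fun[of a], of u] by (simp add: operator_of_nucleus_def)
    qed
  qed
qed

lemma local_operator_iff_nucleus:
  "local_operator j \<longleftrightarrow> (\<exists>k. nucleus k \<and> j = operator_of_nucleus k)"
  using local_operator_of_nucleus nucleus_of_local_operator by blast

lemma operator_of_nucleus_le_iff:
  "local_operator_le (operator_of_nucleus k) (operator_of_nucleus k') \<longleftrightarrow> (\<forall>x. k x \<le> k' x)"
proof
  assume le: "local_operator_le (operator_of_nucleus k) (operator_of_nucleus k')"
  show "\<forall>x. k x \<le> k' x"
  proof
    fix x
    have "operator_of_nucleus k top x \<le> operator_of_nucleus k' top x"
      using le by (simp add: local_operator_le_def Omega_def)
    then show "k x \<le> k' x"
      by (simp add: operator_of_nucleus_def)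
  qed
next
  assume "\<forall>x. k x \<le> k' x"
  then show "local_operator_le (operator_of_nucleus k) (operator_of_nucleus k')"
    by (auto simp: local_operator_le_def Omega_def operator_of_nucleus_def intro: le_infI2)
qed

lemma classifying_le: "x \<in> sec F a \<Longrightarrow> classifying F S a x \<le> a"
  by (auto simp: classifying_def intro: Sup_least)

lemma dense_sub_iff:
  "dense_sub (operator_of_nucleus k) F S \<longleftrightarrow>
    subobject F S \<and> (\<forall>a. \<forall>x\<in>sec F a. a \<le> k (classifying F S a x))"
proof -
  have "x \<in> closure_of_sub (operator_of_nucleus k) F S a \<longleftrightarrow>
      x \<in> sec F a \<and> a \<le> k (classifying F S a x)" for a x
  proof -
    have "mor_comp F (operator_of_nucleus k) (classifying F S) a x = inf a (k (classifying F S a x))"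
      if "x \<in> sec F a"
      using that classifying_le[OF that, of S]
      by (simp add: mor_comp_def compose_def operator_of_nucleus_def)
    then show ?thesis
      by (auto simp: closure_of_sub_def equalizer_def truth_bang inf.absorb_iff1)
  qed
  then show ?thesis
    unfolding dense_sub_def fun_eq_iff set_eq_iff by auto
qed

section \<open>The sublocale of a local operator\<close>

lemma is_sheaf_subterminal: "is_sheaf (subterminal c)"
  by (auto simp: is_sheaf_def is_presheaf_def subterminal_def One_sheaf_def Sup_le_iff)

text \<open>
  Sections of a subterminal sheaf carry no data, so an extension from a dense subobject \<open>S\<close> of \<open>X\<close> exists
  as soon as \<open>X\<close> lives below \<open>c\<close>; by density \<open>X\<close> lives below \<open>k c\<close>.
\<close>

lemma j_sheaf_subterminal_iff:
  assumes k: "nucleus k"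
  shows "j_sheaf (operator_of_nucleus k) (subterminal c) \<longleftrightarrow> k c = c"
proof
  assume sheaf: "j_sheaf (operator_of_nucleus k) (subterminal c)"
  \<comment> \<open>The subterminal sheaf of \<open>c\<close> is dense in that of \<open>k c\<close>, so its identity extends to \<open>k c\<close>.\<close>
  let ?X = "subterminal (k c)" and ?S = "sec (subterminal c)"
  have restrict: "?X\<lparr>sec := ?S\<rparr> = subterminal c"
    by (simp add: subterminal_def)
  have "classifying ?X ?S a x = inf a c" if "x \<in> sec ?X a" for a x
  proof -
    have "{b. b \<le> a \<and> res ?X a b x \<in> ?S b} = {..inf a c}"
      by (auto simp: subterminal_def One_sheaf_def)
    then show ?thesis
      using that by (simp add: classifying_def)
  qed
  moreover have "a \<le> k (inf a c)" if "x \<in> sec ?X a" for a x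
    using that nucleus_le[OF k, of a] by (auto simp: nucleus_inf[OF k] subterminal_def)
  moreover have "subobject ?X ?S"
    using is_sheaf_subterminal[of c] restrict nucleus_le[OF k, of c]
    by (auto simp: subobject_def subterminal_def intro: order_trans)
  ultimately have "dense_sub (operator_of_nucleus k) ?X ?S"
    by (auto simp: dense_sub_iff)
  moreover have "morphism (?X\<lparr>sec := ?S\<rparr>) (subterminal c) (\<lambda>a. \<lambda>x\<in>?S a. x)"
    unfolding restrict by (auto simp: morphism_def subterminal_def One_sheaf_def)
  ultimately obtain \<theta> where "morphism ?X (subterminal c) \<theta>"
    using sheaf is_sheaf_subterminal[of "k c"] unfolding j_sheaf_def by blast
  then have "\<theta> (k c) \<in> sec ?X (k c) \<rightarrow>\<^sub>E sec (subterminal c) (k c)"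
    by (simp add: morphism_def)
  moreover have "k c \<in> sec ?X (k c)"
    by (simp add: subterminal_def One_sheaf_def)
  ultimately have "\<theta> (k c) (k c) \<in> sec (subterminal c) (k c)"
    by (rule PiE_mem)
  then show "k c = c"
    using nucleus_le[OF k, of c] by (simp add: subterminal_def order_antisym)
next
  assume c: "k c = c"
  show "j_sheaf (operator_of_nucleus k) (subterminal c)"
    unfolding j_sheaf_def
  proof (intro conjI allI impI is_sheaf_subterminal)
    fix X :: "('a, 'a) presheaf" and S \<eta>
    assume X: "is_sheaf X" and S: "dense_sub (operator_of_nucleus k) X S"
      and \<eta>: "morphism (X\<lparr>sec := S\<rparr>) (subterminal c) \<eta>"
    have S_le: "b \<le> c" and \<eta>_eq: "\<eta> b y = b" if "y \<in> S b" for b y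
      using \<eta> that by (fastforce simp: morphism_def subterminal_def One_sheaf_def)+
    have X_le: "a \<le> c" if x: "x \<in> sec X a" for a x
    proof -
      have "classifying X S a x \<le> c"
        using x S_le by (auto simp: classifying_def intro: Sup_least)
      then have "k (classifying X S a x) \<le> c"
        using nucleus_mono[OF k, of _ c] c by simp
      then show ?thesis
        using S x by (auto simp: dense_sub_iff intro: order_trans)
    qed
    have res_X: "res X a b x \<in> sec X b" if "b \<le> a" "x \<in> sec X a" for a b x
      using X that by (auto simp: is_sheaf_def is_presheaf_def)
    have S_sub: "S a \<subseteq> sec X a" for a
      using S by (simp add: dense_sub_iff subobject_def)
    show "\<exists>!\<theta>. morphism X (subterminal c) \<theta> \<and> (\<forall>a. \<forall>x\<in>S a. \<theta> a x = \<eta> a x)"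
    proof (rule ex1I[where a = "\<lambda>a. \<lambda>x\<in>sec X a. a"])
      show "morphism X (subterminal c) (\<lambda>a. \<lambda>x\<in>sec X a. a) \<and>
          (\<forall>a. \<forall>x\<in>S a. (\<lambda>x\<in>sec X a. a) x = \<eta> a x)"
        using X_le res_X subsetD[OF S_sub] \<eta>_eq by (auto simp: morphism_def subterminal_def One_sheaf_def)
    next
      fix \<theta> assume "morphism X (subterminal c) \<theta> \<and> (\<forall>a. \<forall>x\<in>S a. \<theta> a x = \<eta> a x)"
      then have \<theta>: "\<theta> a \<in> sec X a \<rightarrow>\<^sub>E {u \<in> {a}. a \<le> c}" for a
        by (simp add: morphism_def subterminal_def One_sheaf_def)
      show "\<theta> = (\<lambda>a. \<lambda>x\<in>sec X a. a)"
        using \<theta> by (intro ext) (auto simp: restrict_def PiE_iff extensional_def)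
    qed
  qed
qed

lemma sublocale_of_subtopos_operator:
  assumes k: "nucleus k"
  shows "sublocale_of_subtopos (operator_of_nucleus k) = k"
proof -
  have "opens k = {c. j_sheaf (operator_of_nucleus k) (subterminal c)}"
    by (simp add: j_sheaf_subterminal_iff[OF k] opens_def)
  then show ?thesis
    unfolding sublocale_of_subtopos_def
    using k by (intro the_equality) (auto intro: nucleus_eqI)
qed

section \<open>The locus of an axiom\<close>

lemma heval_Omega_pow:
  fixes x :: "nat \<Rightarrow> 'a::frame"
  assumes "vars \<phi> \<subseteq> {..<n}" "b \<le> a" "x \<in> sec (Omega_pow n) a"
  shows "heval {..b} (res (Omega_pow n) a b x) \<phi> = inf b (heval UNIV x \<phi>)"
proof -
  have "heval {..b} (res (Omega_pow n) a b x) \<phi> = heval {..b} (\<lambda>i. inf b (x i)) \<phi>"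
    using assms(1) by (intro heval_cong) (auto simp: Omega_pow_def Omega_def inf.commute)
  then show ?thesis
    by (simp add: heval_down)
qed

lemma res_Omega_pow_self: "x \<in> sec (Omega_pow n) a \<Longrightarrow> res (Omega_pow n) a a x = x"
  by (auto simp: fun_eq_iff Omega_pow_def Omega_def PiE_iff extensional_def inf.absorb1)

lemma res_Omega_pow_mem:
  "b \<le> a \<Longrightarrow> x \<in> sec (Omega_pow n) a \<Longrightarrow> res (Omega_pow n) a b x \<in> sec (Omega_pow n) b"
  by (auto simp: Omega_pow_def Omega_def)

lemma res_Omega_pow_res:
  "c \<le> b \<Longrightarrow> res (Omega_pow n) b c (res (Omega_pow n) a b x) = res (Omega_pow n) a c x"
  by (auto simp: fun_eq_iff Omega_pow_def Omega_def inf.absorb2 inf.assoc)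

lemma mem_axiom_locus_iff:
  assumes "vars \<phi> \<subseteq> {..<n}"
  shows "x \<in> axiom_locus n \<phi> a \<longleftrightarrow> x \<in> sec (Omega_pow n) a \<and> a \<le> heval UNIV x \<phi>"
proof -
  have "heval {..a} x \<phi> = inf a (heval UNIV x \<phi>)" if x: "x \<in> sec (Omega_pow n) a"
    using heval_Omega_pow[OF assms order_refl x] by (simp add: res_Omega_pow_self x)
  moreover have "sec Omega a = {..a}"
    by (simp add: Omega_def)
  ultimately show ?thesis
    by (auto simp: axiom_locus_def equalizer_def interp_Omega_def truth_bang inf.absorb_iff1)
qed

text \<open>
  Since restriction is a homomorphism, a tuple lies in the locus over \<open>b\<close> exactly when \<open>b\<close> lies below
  the value of \<open>\<phi>\<close> in the whole frame; this makes that value classify the locus.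
\<close>

lemma res_mem_axiom_locus_iff:
  assumes "vars \<phi> \<subseteq> {..<n}" "b \<le> a" "x \<in> sec (Omega_pow n) a"
  shows "res (Omega_pow n) a b x \<in> axiom_locus n \<phi> b \<longleftrightarrow> b \<le> heval UNIV x \<phi>"
proof -
  let ?y = "res (Omega_pow n) a b x"
  have y: "?y \<in> sec (Omega_pow n) b"
    using assms(2,3) by (rule res_Omega_pow_mem)
  have "inf b (heval UNIV ?y \<phi>) = inf b (heval UNIV x \<phi>)"
    using heval_Omega_pow[OF assms] heval_Omega_pow[OF assms(1) order_refl y]
    by (simp add: res_Omega_pow_self[OF y])
  then show ?thesis
    using y by (simp add: mem_axiom_locus_iff[OF assms(1)] inf.absorb_iff1)
qed

lemma classifying_axiom_locus:
  assumes "vars \<phi> \<subseteq> {..<n}" "x \<in> sec (Omega_pow n) a"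
  shows "classifying (Omega_pow n) (axiom_locus n \<phi>) a x = inf a (heval UNIV x \<phi>)"
proof -
  have "{b. b \<le> a \<and> res (Omega_pow n) a b x \<in> axiom_locus n \<phi> b} = {..inf a (heval UNIV x \<phi>)}"
    using assms by (auto simp: res_mem_axiom_locus_iff)
  then show ?thesis
    using assms(2) by (simp add: classifying_def)
qed

text \<open>
  Sections of the powers of \<open>\<Omega>\<close> are glued by componentwise joins, and the locus is closed under gluing
  because a term holds over a join as soon as it holds over the parts.
\<close>

lemma subobject_axiom_locus:
  assumes \<phi>: "vars \<phi> \<subseteq> {..<n}"
  shows "subobject (Omega_pow n :: ('a::frame, _) presheaf) (axiom_locus n \<phi>)"
proof -
  let ?P = "Omega_pow n :: ('a, nat \<Rightarrow> 'a) presheaf" and ?S = "axiom_locus n \<phi> :: 'a \<Rightarrow> _"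
  have S_sub: "?S a \<subseteq> sec ?P a" for a
    using \<phi> by (auto simp: mem_axiom_locus_iff)
  have "is_presheaf (?P\<lparr>sec := ?S\<rparr>)"
    unfolding is_presheaf_def
  proof (intro conjI allI impI ballI)
    fix a b :: 'a assume "b \<le> a"
    then have "res ?P a b x \<in> ?S b" if "x \<in> ?S a" for x
      using that
      by (intro res_mem_axiom_locus_iff[OF \<phi>, THEN iffD2])
        (auto simp: mem_axiom_locus_iff[OF \<phi>] intro: order_trans)
    then show "res (?P\<lparr>sec := ?S\<rparr>) a b \<in> sec (?P\<lparr>sec := ?S\<rparr>) a \<rightarrow> sec (?P\<lparr>sec := ?S\<rparr>) b"
      by simp
  qed (use S_sub in \<open>auto simp: res_Omega_pow_self res_Omega_pow_res subset_iff\<close>)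
  moreover have "\<exists>!x. x \<in> ?S (Sup U) \<and> (\<forall>u\<in>U. res ?P (Sup U) u x = s u)"
    if s: "\<forall>u\<in>U. s u \<in> ?S u"
      and compat: "\<forall>u\<in>U. \<forall>v\<in>U. res ?P u (inf u v) (s u) = res ?P v (inf u v) (s v)" for U s
  proof -
    have s_sec: "s u \<in> {..<n} \<rightarrow>\<^sub>E {..u}" if "u \<in> U" for u
      using s S_sub[of u] that by (auto simp: Omega_pow_def Omega_def)
    have s_le: "s u i \<le> u" if "u \<in> U" "i < n" for u i
      using s_sec[OF that(1)] that(2) by auto
    have s_compat: "inf u (s v i) \<le> s u i" if "u \<in> U" "v \<in> U" "i < n" for u v i
    proof -
      have "res ?P u (inf u v) (s u) i = res ?P v (inf u v) (s v) i"
        using compat that(1,2) by metis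
      then have "inf (s u i) (inf u v) = inf (s v i) (inf u v)"
        using that(3) by (simp add: Omega_pow_def Omega_def)
      moreover have "inf u (s v i) = inf (s v i) (inf u v)"
        using s_le[OF that(2,3)] by (simp add: inf.absorb1 inf_left_commute)
      ultimately show ?thesis
        by (metis inf.cobounded1)
    qed
    define x where "x = (\<lambda>i\<in>{..<n}. Sup ((\<lambda>u. s u i) ` U))"
    have x: "x \<in> sec ?P (Sup U)"
      using s_le by (auto simp: x_def Omega_pow_def Omega_def intro!: Sup_least Sup_upper2)
    have x_res: "res ?P (Sup U) u x = s u" if u: "u \<in> U" for u
    proof
      fix i
      show "res ?P (Sup U) u x i = s u i"
      proof (cases "i < n")
        case True
        have "inf u (Sup ((\<lambda>v. s v i) ` U)) = s u i"
        proof (rule order_antisym)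
          show "inf u (Sup ((\<lambda>v. s v i) ` U)) \<le> s u i"
            using s_compat[OF u _ True] by (auto simp: inf_Sup_frame image_image intro!: Sup_least)
          show "s u i \<le> inf u (Sup ((\<lambda>v. s v i) ` U))"
            using s_le[OF u True] u by (auto intro: Sup_upper)
        qed
        then show ?thesis
          using True by (simp add: Omega_pow_def Omega_def x_def inf.commute)
      next
        case False
        then show ?thesis
          using PiE_arb[OF s_sec[OF u], of i] by (simp add: Omega_pow_def)
      qed
    qed
    show ?thesis
    proof (rule ex1I[where a = x])
      have "u \<le> heval UNIV x \<phi>" if "u \<in> U" for u
        using res_mem_axiom_locus_iff[OF \<phi> Sup_upper[OF that] x] x_res[OF that] s that by simp
      then show "x \<in> ?S (Sup U) \<and> (\<forall>u\<in>U. res ?P (Sup U) u x = s u)"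
        using x x_res by (auto simp: mem_axiom_locus_iff[OF \<phi>] intro: Sup_least)
    next
      fix y assume y: "y \<in> ?S (Sup U) \<and> (\<forall>u\<in>U. res ?P (Sup U) u y = s u)"
      then have y_sec: "y \<in> {..<n} \<rightarrow>\<^sub>E {..Sup U}"
        using S_sub[of "Sup U"] by (auto simp: Omega_pow_def Omega_def)
      show "y = x"
      proof
        fix i
        show "y i = x i"
        proof (cases "i < n")
          case True
          have "s u i = inf (y i) u" if "u \<in> U" for u
          proof -
            have "s u i = res ?P (Sup U) u y i"
              using y that by simp
            then show ?thesis
              using True by (simp add: Omega_pow_def Omega_def)
          qed
          then have "Sup ((\<lambda>u. s u i) ` U) = Sup (inf (y i) ` U)"
            by (metis (no_types, lifting) image_cong)
          also have "\<dots> = y i"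
            using PiE_mem[OF y_sec, of i] True by (simp add: inf.absorb1 flip: inf_Sup_frame)
          finally show ?thesis
            using True by (simp add: x_def)
        next
          case False
          then show ?thesis
            using PiE_arb[OF y_sec, of i] by (simp add: x_def)
        qed
      qed
    qed
  qed
  ultimately show ?thesis
    using S_sub by (simp add: subobject_def is_sheaf_def)
qed

definition validates :: "('a::frame \<Rightarrow> 'a) \<Rightarrow> hterm \<Rightarrow> bool" where
  "validates k \<phi> \<longleftrightarrow> (\<forall>x. k (heval UNIV x \<phi>) = top)"

lemma dense_axiom_locus_iff:
  fixes k :: "'a::frame \<Rightarrow> 'a"
  assumes \<phi>: "vars \<phi> \<subseteq> {..<n}" and k: "nucleus k"
  shows "dense_sub (operator_of_nucleus k) (Omega_pow n) (axiom_locus n \<phi>) \<longleftrightarrow> validates k \<phi>"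
proof -
  have "(\<forall>a. \<forall>x\<in>sec (Omega_pow n) a. a \<le> k (inf a (heval UNIV x \<phi>))) \<longleftrightarrow> validates k \<phi>"
  proof
    assume dense: "\<forall>a. \<forall>x\<in>sec (Omega_pow n) a. a \<le> k (inf a (heval UNIV x \<phi>))"
    have "top \<le> k (heval UNIV x \<phi>)" for x
    proof -
      have "restrict x {..<n} \<in> sec (Omega_pow n) top"
        by (simp add: Omega_pow_def Omega_def)
      then have "top \<le> k (inf top (heval UNIV (restrict x {..<n}) \<phi>))"
        using dense by blast
      moreover have "heval UNIV (restrict x {..<n}) \<phi> = heval UNIV x \<phi>"
        using \<phi> by (intro heval_cong) auto
      ultimately show ?thesis
        by simp
    qed
    then show "validates k \<phi>"
      by (simp add: validates_def top_unique)
  next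
    assume "validates k \<phi>"
    then show "\<forall>a. \<forall>x\<in>sec (Omega_pow n) a. a \<le> k (inf a (heval UNIV x \<phi>))"
      by (simp add: validates_def nucleus_inf[OF k] nucleus_le[OF k])
  qed
  then show ?thesis
    by (simp add: dense_sub_iff subobject_axiom_locus[OF \<phi>] classifying_axiom_locus[OF \<phi>])
qed

section \<open>The least nucleus validating an axiom\<close>

definition least_validating_nucleus :: "hterm \<Rightarrow> 'a::frame \<Rightarrow> 'a" where
  "least_validating_nucleus \<phi> x = Inf {k x | k. nucleus k \<and> validates k \<phi>}"

lemma least_validating_nucleus_le:
  "nucleus k \<Longrightarrow> validates k \<phi> \<Longrightarrow> least_validating_nucleus \<phi> x \<le> k x"
  unfolding least_validating_nucleus_def by (auto intro: Inf_lower)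

lemma le_least_validating_nucleus:
  "(\<And>k. nucleus k \<Longrightarrow> validates k \<phi> \<Longrightarrow> y \<le> k x) \<Longrightarrow> y \<le> least_validating_nucleus \<phi> x"
  unfolding least_validating_nucleus_def by (auto intro: Inf_greatest)

text \<open>
  Pointwise infima of nuclei are again nuclei: for idempotence, each competitor \<open>k\<close> satisfies
  \<open>l (l x) \<le> k (k x) = k x\<close>. Arbitrary suprema would require an iteration.
\<close>

lemma nucleus_least_validating: "nucleus (least_validating_nucleus \<phi>)"
  unfolding nucleus_def
proof (intro conjI allI)
  let ?l = "least_validating_nucleus \<phi>"
  show infl: "x \<le> ?l x" for x
    by (auto intro: le_least_validating_nucleus nucleus_le)
  show "?l (?l x) = ?l x" for x
  proof (rule order_antisym)
    show "?l (?l x) \<le> ?l x"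
      by (rule le_least_validating_nucleus)
        (metis least_validating_nucleus_le nucleus_idem nucleus_mono order_trans)
  qed (rule infl)
  show "?l (inf x y) = inf (?l x) (?l y)" for x y
  proof (rule order_antisym)
    show "?l (inf x y) \<le> inf (?l x) (?l y)"
      by (intro le_infI le_least_validating_nucleus)
        (metis inf.cobounded1 inf.cobounded2 least_validating_nucleus_le nucleus_mono order_trans)+
    show "inf (?l x) (?l y) \<le> ?l (inf x y)"
      by (rule le_least_validating_nucleus)
        (simp add: nucleus_inf least_validating_nucleus_le le_infI1 le_infI2)
  qed
qed

lemma validates_least_validating:
  "validates (least_validating_nucleus \<phi> :: 'a::frame \<Rightarrow> 'a) \<phi>"
proof -
  have "top \<le> least_validating_nucleus \<phi> (heval UNIV x \<phi>)" for x :: "nat \<Rightarrow> 'a"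
    by (rule le_least_validating_nucleus) (simp add: validates_def)
  then show ?thesis
    by (simp add: validates_def top_unique)
qed

lemma L_topology_eq:
  assumes \<phi>: "vars \<phi> \<subseteq> {..<n}"
  shows "(L_topology n \<phi> :: 'a::frame \<Rightarrow> _) = operator_of_nucleus (least_validating_nucleus \<phi>)"
  unfolding L_topology_def
proof (rule the_equality)
  let ?l = "least_validating_nucleus \<phi> :: 'a \<Rightarrow> 'a"
  have least: "local_operator_le (operator_of_nucleus ?l) j"
    if "local_operator j" "dense_sub j (Omega_pow n) (axiom_locus n \<phi>)" for j :: "'a \<Rightarrow> 'a \<Rightarrow> 'a"
    using that
    by (auto simp: local_operator_iff_nucleus dense_axiom_locus_iff[OF \<phi>]
        operator_of_nucleus_le_iff least_validating_nucleus_le)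
  have dense: "dense_sub (operator_of_nucleus ?l) (Omega_pow n) (axiom_locus n \<phi>)"
    by (simp add: dense_axiom_locus_iff[OF \<phi>] nucleus_least_validating validates_least_validating)
  have local: "local_operator (operator_of_nucleus ?l)"
    by (rule local_operator_of_nucleus[OF nucleus_least_validating])
  show "local_operator (operator_of_nucleus ?l) \<and>
      dense_sub (operator_of_nucleus ?l) (Omega_pow n) (axiom_locus n \<phi>) \<and>
      (\<forall>j. local_operator j \<and> dense_sub j (Omega_pow n) (axiom_locus n \<phi>) \<longrightarrow>
        local_operator_le (operator_of_nucleus ?l) j)"
    by (intro conjI allI impI local dense) (simp add: least)
  fix j :: "'a \<Rightarrow> 'a \<Rightarrow> 'a"
  assume j: "local_operator j \<and> dense_sub j (Omega_pow n) (axiom_locus n \<phi>) \<and>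
      (\<forall>j'. local_operator j' \<and> dense_sub j' (Omega_pow n) (axiom_locus n \<phi>) \<longrightarrow>
        local_operator_le j j')"
  then have "local_operator_le (operator_of_nucleus ?l) j" "local_operator_le j (operator_of_nucleus ?l)"
    using local dense by (simp_all add: least)
  moreover obtain k where k: "nucleus k" "j = operator_of_nucleus k"
    using j by (auto simp: local_operator_iff_nucleus)
  ultimately have "k = ?l"
    by (auto simp: k(2) operator_of_nucleus_le_iff le_fun_def intro!: order_antisym)
  then show "j = operator_of_nucleus ?l"
    by (simp add: k(2))
qed

lemma L_sublocale_eq:
  assumes "vars \<phi> \<subseteq> {..<n}"
  shows "L_sublocale n \<phi> = least_validating_nucleus \<phi>"
  by (simp add: L_sublocale_def L_topology_eq[OF assms]
      sublocale_of_subtopos_operator[OF nucleus_least_validating])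

section \<open>Density, validity and universality\<close>

lemma axiom_in_axiomatized_logic: "\<phi> \<in> axiomatized_logic \<phi>"
proof -
  have "hsubst Var \<phi> = \<phi>"
    by (induction \<phi>) auto
  then show ?thesis
    using axiomatized_logic.axiom_scheme[of Var \<phi>] by simp
qed

lemma dense_least_validating:
  assumes "intermediate_logic (axiomatized_logic \<phi>)"
  shows "dense_nucleus (least_validating_nucleus \<phi> :: 'a::frame \<Rightarrow> 'a)"
proof -
  have "\<phi> \<in> classical_logic"
    using assms axiom_in_axiomatized_logic by (auto simp: intermediate_logic_def)
  then have "validates (\<lambda>x::'a. himp (himp x bot) bot) \<phi>"
    by (simp add: validates_def Glivenko himp_eq_top_iff)
  then have "least_validating_nucleus \<phi> (bot::'a) \<le> himp (himp bot bot) bot"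
    by (rule least_validating_nucleus_le[OF nucleus_double_negation])
  also have "himp (himp bot bot) bot = (bot::'a)"
    using inf_himp_le[of top "bot::'a"] by (simp add: himp_eq_top_iff[THEN iffD2] bot_unique)
  finally show ?thesis
    by (simp add: dense_nucleus_def nucleus_least_validating bot_unique)
qed

lemma validates_iff_sublocale_le:
  assumes k: "nucleus k"
  shows "validates k \<phi> \<longleftrightarrow> sublocale_le k (least_validating_nucleus \<phi>)"
proof
  assume "validates k \<phi>"
  then show "sublocale_le k (least_validating_nucleus \<phi>)"
    using k by (simp add: sublocale_le_def least_validating_nucleus_le)
next
  assume "sublocale_le k (least_validating_nucleus \<phi>)"
  then show "validates k \<phi>"
    using validates_least_validating[of \<phi>] by (metis sublocale_le_def top_unique validates_def)
qed

text \<open>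
  When the quotient map is a homomorphism for the connectives of \<open>\<phi>\<close>, it carries the values of \<open>\<phi>\<close> in the
  frame onto those in the sublocale, because it is surjective with the inclusion as a section.
\<close>

lemma satisfies_identity_iff_validates:
  assumes k: "weakly_open k" and imp: "implicationally_open k \<or> Imp_free \<phi>"
  shows "satisfies_identity (opens k) \<phi> \<longleftrightarrow> validates k \<phi>"
proof -
  have n: "nucleus k"
    using k by (simp add: weakly_open_def)
  have hom: "heval (opens k) (\<lambda>i. k (x i)) \<phi> = k (heval UNIV x \<phi>)" for x
    using k imp by (intro heval_nucleus) (auto simp: weakly_open_def implicationally_open_def)
  show ?thesis
  proof
    assume sat: "satisfies_identity (opens k) \<phi>"
    have "range (\<lambda>i. k (x i)) \<subseteq> opens k" for x :: "nat \<Rightarrow> 'a"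
      by (auto simp: nucleus_in_opens[OF n])
    then show "validates k \<phi>"
      using sat by (simp add: satisfies_identity_def validates_def one_on_opens[OF n] flip: hom)
  next
    assume val: "validates k \<phi>"
    have "heval (opens k) x \<phi> = top" if "range x \<subseteq> opens k" for x
    proof -
      have "(\<lambda>i. k (x i)) = x"
        using that by (auto simp: opens_def)
      then show ?thesis
        using hom[of x] val by (simp add: validates_def)
    qed
    then show "satisfies_identity (opens k) \<phi>"
      by (simp add: satisfies_identity_def one_on_opens[OF n])
  qed
qed

theorem proposition4p6:
  fixes n :: nat and \<phi> :: hterm
  assumes "vars \<phi> \<subseteq> {..<n}"
    and "intermediate_logic (axiomatized_logic \<phi>)"
    and "Or_of_Or_free \<phi>"
  shows "dense_nucleus (L_sublocale n \<phi> :: 'a::frame \<Rightarrow> 'a) \<and>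
    satisfies_identity (opens (L_sublocale n \<phi> :: 'a \<Rightarrow> 'a)) \<phi> \<and>
    (\<forall>k :: 'a \<Rightarrow> 'a. implicationally_open k \<longrightarrow>
      (sublocale_le k (L_sublocale n \<phi>) \<longleftrightarrow> satisfies_identity (opens k) \<phi>)) \<and>
    (Imp_free \<phi> \<longrightarrow> (\<forall>k :: 'a \<Rightarrow> 'a. weakly_open k \<longrightarrow>
      (sublocale_le k (L_sublocale n \<phi>) \<longleftrightarrow> satisfies_identity (opens k) \<phi>)))"
  unfolding L_sublocale_eq[OF assms(1)]
proof (intro conjI allI impI)
  let ?l = "least_validating_nucleus \<phi> :: 'a \<Rightarrow> 'a"
  show dense: "dense_nucleus ?l"
    by (rule dense_least_validating[OF assms(2)])
  show "satisfies_identity (opens ?l) \<phi>"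
    using heval_opens_Or_of_Or_free[OF dense _ assms(3)] validates_least_validating[of \<phi>, where 'a = 'a]
    by (simp add: satisfies_identity_def validates_def one_on_opens[OF nucleus_least_validating])
  fix k :: "'a \<Rightarrow> 'a"
  show "sublocale_le k ?l \<longleftrightarrow> satisfies_identity (opens k) \<phi>" if "implicationally_open k"
    using that implicationally_open_imp_weakly_open[OF that]
    by (simp add: satisfies_identity_iff_validates validates_iff_sublocale_le weakly_open_def)
  show "sublocale_le k ?l \<longleftrightarrow> satisfies_identity (opens k) \<phi>" if "Imp_free \<phi>" "weakly_open k"
    using that
    by (simp add: satisfies_identity_iff_validates validates_iff_sublocale_le weakly_open_def)
qed

end
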